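(* Let $a\ge 0$ and let $r>0$, $p>0$ and $q$ be continuous real functions on $[a,\infty)$. Suppose that the first systems-focal point $\hat\mu_1=\hat\mu_1(a)$ exists for the equation $(r(x)y'')''-(q(x)y')'=p(x)y$. Then it is realized by an eigenfunction $y_{\hat\mu_1}$ which is unique up to a multiplicative constant, i.e. the solutions satisfying $y(a)=y_1(a)=y'(\hat\mu_1)=Ty(\hat\mu_1)=0$ form a one-dimensional space spanned by $y_{\hat\mu_1}$. With a suitable choice of the multiplicative constant it satisfies $$y_{\hat\mu_1}>0,\quad y'_{\hat\mu_1}>0,\quad T(y_{\hat\mu_1})<0\quad\text{on }(a,\hat\mu_1).$$ Also, if $q\le 0$ on $[a,\hat\mu_1)$, then $y''_{\hat\mu_1}<0$ on $(a,\hat\mu_1)$.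
   Context: For a function $y$ put $y_1=ry''$ and $Ty=(ry'')'-qy'$. A solution of $(ry'')''-(qy')'=py$ is a function $y$ such that $y,y',y_1,Ty$ are continuously differentiable and $(Ty)'=py$. The systems-focal point $\hat\mu_1(a)$ is the smallest $b\in(a,\infty)$ for which there is a nontrivial solution with $y(a)=y_1(a)=y'(b)=Ty(b)=0$; it exists if such a $b$ exists. *)

theory Defs
  imports "HOL-Analysis.Analysis"
begin

text \<open>
  All functions live on \<open>[a, \<infinity>)\<close>: derivatives are taken within \<^term>\<open>{a..}\<close> (so they are
  right-hand derivatives at \<open>a\<close>), and values to the left of \<open>a\<close> are irrelevant.
\<close>

definition deriv_from :: "real \<Rightarrow> (real \<Rightarrow> real) \<Rightarrow> real \<Rightarrow> real" where
  "deriv_from a f x = vector_derivative f (at x within {a..})"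

definition cont_diff_from :: "real \<Rightarrow> (real \<Rightarrow> real) \<Rightarrow> bool" where
  "cont_diff_from a f \<longleftrightarrow> f differentiable_on {a..} \<and> continuous_on {a..} (deriv_from a f)"

definition quasi_y1 :: "real \<Rightarrow> (real \<Rightarrow> real) \<Rightarrow> (real \<Rightarrow> real) \<Rightarrow> real \<Rightarrow> real" where
  "quasi_y1 a r y = (\<lambda>x. r x * deriv_from a (deriv_from a y) x)"

definition quasi_T ::
  "real \<Rightarrow> (real \<Rightarrow> real) \<Rightarrow> (real \<Rightarrow> real) \<Rightarrow> (real \<Rightarrow> real) \<Rightarrow> real \<Rightarrow> real" where
  "quasi_T a r q y = (\<lambda>x. deriv_from a (quasi_y1 a r y) x - q x * deriv_from a y x)"

text \<open>Solutions on \<open>[a, \<infinity>)\<close> of \<open>(r y'')'' - (q y')' = p y\<close>.\<close>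

definition is_solution ::
  "real \<Rightarrow> (real \<Rightarrow> real) \<Rightarrow> (real \<Rightarrow> real) \<Rightarrow> (real \<Rightarrow> real) \<Rightarrow> (real \<Rightarrow> real) \<Rightarrow> bool" where
  "is_solution a r q p y \<longleftrightarrow>
     cont_diff_from a y \<and> cont_diff_from a (deriv_from a y) \<and>
     cont_diff_from a (quasi_y1 a r y) \<and> cont_diff_from a (quasi_T a r q y) \<and>
     (\<forall>x\<ge>a. deriv_from a (quasi_T a r q y) x = p x * y x)"

text \<open>The space of all solutions, including zero, with the systems-focal boundary conditions at
  \<open>a\<close> and \<open>b\<close>.\<close>

definition systems_focal_solutions ::
  "real \<Rightarrow> (real \<Rightarrow> real) \<Rightarrow> (real \<Rightarrow> real) \<Rightarrow> (real \<Rightarrow> real) \<Rightarrow> real \<Rightarrow> (real \<Rightarrow> real) set" where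
  "systems_focal_solutions a r q p b =
     {y. is_solution a r q p y \<and> y a = 0 \<and> quasi_y1 a r y a = 0 \<and>
         deriv_from a y b = 0 \<and> quasi_T a r q y b = 0}"

definition systems_focal_points ::
  "real \<Rightarrow> (real \<Rightarrow> real) \<Rightarrow> (real \<Rightarrow> real) \<Rightarrow> (real \<Rightarrow> real) \<Rightarrow> real set" where
  "systems_focal_points a r q p =
     {b. a < b \<and> (\<exists>y \<in> systems_focal_solutions a r q p b. \<exists>x\<ge>a. y x \<noteq> 0)}"

text \<open>Meaningful only when \<^const>\<open>systems_focal_points\<close> has a smallest element.\<close>

definition mu1_hat ::
  "real \<Rightarrow> (real \<Rightarrow> real) \<Rightarrow> (real \<Rightarrow> real) \<Rightarrow> (real \<Rightarrow> real) \<Rightarrow> real" where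
  "mu1_hat a r q p = (LEAST b. b \<in> systems_focal_points a r q p)"

end

theory Submission
  imports Defs
begin

text \<open>
  With \<open>u = y'\<close>, \<open>v = r y''\<close> and \<open>T = v' - q u\<close> the equation is the linear first-order system
  \<open>y' = u\<close>, \<open>u' = v / r\<close>, \<open>v' = T + q u\<close>, \<open>T' = p y\<close>. Its solutions with \<open>y(a) = v(a) = 0\<close> form a plane,
  spanned by a solution \<open>1\<close> with \<open>u(a) = 1\<close>, \<open>T(a) = 0\<close> and a solution \<open>2\<close> with \<open>u(a) = 0\<close>, \<open>T(a) = 1\<close>.
  The two conditions at \<open>b\<close> can be met by a nontrivial member of this plane only if the minor
  \<open>W = u1 T2 - u2 T1\<close> vanishes at \<open>b\<close>. As \<open>W(a) = 1\<close>, the minor has a first zero \<open>\<mu>\<close> whenever there is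
  a focal point, and the point is to show that \<open>\<mu>\<close> is focal and to read off the signs.

  What makes this work is that the second minor \<open>M = u1 v2 - u2 v1\<close> satisfies \<open>M' = W\<close>
  (\<open>minor_uv_has_derivative\<close>) and \<open>M(a) = 0\<close>. Hence \<open>M > 0\<close> on \<open>(a, \<mu>]\<close>, and this has two consequences.
  Firstly, \<open>u2 > 0\<close> on \<open>(a, \<mu>]\<close> (\<open>u2_pos\<close>): at a first zero of \<open>u2\<close> the inequalities \<open>W \<ge> 0\<close> and \<open>M > 0\<close>
  would force \<open>u1 \<ge> 0\<close> and \<open>u1 v2 > 0\<close>, whereas \<open>v2 \<le> 0\<close> there. Secondly, \<open>(u1 / u2)' = - M / (r u2^2)\<close>,
  so \<open>u1 / u2\<close> decreases strictly (\<open>ratio_decreasing\<close>). With \<open>k = u1(\<mu>) / u2(\<mu>)\<close> the solution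
  \<open>y = y1 - k y2\<close> therefore has \<open>y' = u2 (u1 / u2 - k) > 0\<close> before \<open>\<mu>\<close> and \<open>y'(\<mu>) = 0\<close>, while \<open>W(\<mu>) = 0\<close>
  gives \<open>T(\<mu>) = 0\<close>. The remaining signs follow by integrating the system: \<open>y > 0\<close> from the left
  end, \<open>T < 0\<close> from the right end, and \<open>v < 0\<close> when \<open>q \<le> 0\<close>. Since \<open>u2(\<mu>) \<noteq> 0\<close>, the single condition
  \<open>y'(\<mu>) = 0\<close> already cuts the plane down to a line, which is the uniqueness claim.

  The two basic solutions are produced by the Picard series and shown to span by an energy
  estimate; both arguments are carried out for a continuous bounded operator as coefficient.
\<close>

section \<open>Linear initial value problems on a half-line\<close>

lemma at_within_atLeast_eq_Icc:
  fixes a b t :: real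
  assumes "a \<le> t" "t < b"
  shows "at t within {a..} = at t within {a..b}"
  by (rule at_within_nhd[where S = "{..<b}"]) (use assms in auto)

lemma integral_has_vector_derivative_atLeast:
  fixes f :: "real \<Rightarrow> 'a::banach"
  assumes f: "continuous_on {a..} f" and t: "a \<le> t"
  shows "((\<lambda>x. integral {a..x} f) has_vector_derivative f t) (at t within {a..})"
proof -
  have "continuous_on {a..t + 1} f"
    by (rule continuous_on_subset[OF f]) auto
  then have "((\<lambda>x. integral {a..x} f) has_vector_derivative f t) (at t within {a..t + 1})"
    by (rule integral_has_vector_derivative) (use t in auto)
  then show ?thesis
    using at_within_atLeast_eq_Icc[of a t "t + 1"] t by simp
qed

text \<open>The terms are the successive corrections of Picard iteration, so that the solution is their sum
  rather than the limit of the iterates.\<close>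

primrec picard_term ::
  "real \<Rightarrow> (real \<Rightarrow> 'a \<Rightarrow>\<^sub>L 'a) \<Rightarrow> 'a \<Rightarrow> nat \<Rightarrow> real \<Rightarrow> ('a::banach)" where
  "picard_term a L c 0 = (\<lambda>t. c)"
| "picard_term a L c (Suc n) = (\<lambda>t. integral {a..t} (\<lambda>s. blinfun_apply (L s) (picard_term a L c n s)))"

fun picard_slope ::
  "real \<Rightarrow> (real \<Rightarrow> 'a \<Rightarrow>\<^sub>L 'a) \<Rightarrow> 'a \<Rightarrow> nat \<Rightarrow> real \<Rightarrow> ('a::banach)" where
  "picard_slope a L c 0 = (\<lambda>t. 0)"
| "picard_slope a L c (Suc n) = (\<lambda>t. blinfun_apply (L t) (picard_term a L c n t))"

lemma continuous_on_picard_term: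
  fixes L :: "real \<Rightarrow> ('a::banach) \<Rightarrow>\<^sub>L 'a"
  assumes L: "continuous_on {a..} L"
  shows "continuous_on {a..} (picard_term a L c n)"
proof (induction n)
  case (Suc n)
  have "continuous_on {a..} (\<lambda>s. blinfun_apply (L s) (picard_term a L c n s))"
    by (intro continuous_intros L Suc)
  from integral_has_vector_derivative_atLeast[OF this] show ?case
    by (auto simp: continuous_on_eq_continuous_within intro!: has_vector_derivative_continuous)
qed simp

lemma picard_term_has_derivative:
  fixes L :: "real \<Rightarrow> ('a::banach) \<Rightarrow>\<^sub>L 'a"
  assumes L: "continuous_on {a..} L" and t: "a \<le> t"
  shows "(picard_term a L c n has_vector_derivative picard_slope a L c n t) (at t within {a..})"
proof (cases n)
  case (Suc m)
  have "continuous_on {a..} (\<lambda>s. blinfun_apply (L s) (picard_term a L c m s))"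
    by (intro continuous_intros L continuous_on_picard_term)
  from integral_has_vector_derivative_atLeast[OF this t] show ?thesis
    by (simp add: Suc)
qed simp

text \<open>The weight \<open>exp (2 * K * (t - a))\<close> makes one integration against \<open>K\<close> cost a factor \<open>1/2\<close>, so
  the Picard series is dominated by a geometric series on every compact interval.\<close>

lemma norm_picard_term_le:
  fixes L :: "real \<Rightarrow> ('a::banach) \<Rightarrow>\<^sub>L 'a"
  assumes L: "continuous_on {a..} L"
    and K: "0 < K" "\<And>t. a \<le> t \<Longrightarrow> t \<le> b \<Longrightarrow> norm (L t) \<le> K"
    and t: "a \<le> t" "t \<le> b"
  shows "norm (picard_term a L c n t) \<le> norm c * (1/2) ^ n * exp (2 * K * (t - a))"
  using t
proof (induction n arbitrary: t)
  case 0
  have "1 \<le> exp (2 * K * (t - a))"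
    using 0 K by simp
  then show ?case
    using mult_left_mono[of 1 _ "norm c"] by simp
next
  case (Suc n)
  show ?case
  proof (cases "t = a")
    case True
    then show ?thesis by simp
  next
    case False
    (* the derivative of phi is K times the bound for the preceding term *)
    define phi where "phi = (\<lambda>s. norm c * (1/2) ^ Suc n * exp (2 * K * (s - a)))"
    have "norm (picard_term a L c (Suc n) t - picard_term a L c (Suc n) a) \<le> phi t - phi a"
    proof (rule differentiable_bound_general)
      show "a < t" using False Suc.prems by simp
      show "continuous_on {a..t} (picard_term a L c (Suc n))"
        by (rule continuous_on_subset[OF continuous_on_picard_term[OF L]]) auto
      show "continuous_on {a..t} phi"
        unfolding phi_def by (intro continuous_intros)
      fix s assume s: "a < s" "s < t"
      have "at s within {a..} = at s"
        using s by (intro at_within_interior) auto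
      then show "(picard_term a L c (Suc n) has_vector_derivative picard_slope a L c (Suc n) s) (at s)"
        using picard_term_has_derivative[OF L, of s c "Suc n"] s by simp
      show "(phi has_vector_derivative K * (norm c * (1/2) ^ n * exp (2 * K * (s - a)))) (at s)"
        unfolding phi_def has_real_derivative_iff_has_vector_derivative[symmetric]
        by (auto intro!: derivative_eq_intros simp: field_simps)
      have "norm (picard_slope a L c (Suc n) s) \<le> norm (L s) * norm (picard_term a L c n s)"
        by (simp add: norm_blinfun)
      also have "\<dots> \<le> K * (norm c * (1/2) ^ n * exp (2 * K * (s - a)))"
        using s Suc.prems K by (intro mult_mono Suc.IH) auto
      finally show "norm (picard_slope a L c (Suc n) s) \<le> \<dots>" .
    qed
    moreover have "0 \<le> phi a"
      by (simp add: phi_def)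
    moreover have "picard_term a L c (Suc n) a = 0"
      by simp
    ultimately have "norm (picard_term a L c (Suc n) t) \<le> phi t"
      by (simp del: picard_term.simps)
    then show ?thesis
      unfolding phi_def .
  qed
qed

text \<open>The Picard series and its termwise derivative converge uniformly on compact intervals, and the
  derivatives sum to the coefficient applied to the series, because each one is the coefficient
  applied to the preceding term.\<close>

lemma linear_ivp_solution_exists:
  fixes L :: "real \<Rightarrow> ('a::banach) \<Rightarrow>\<^sub>L 'a"
  assumes L: "continuous_on {a..} L"
  shows "\<exists>X. X a = c \<and> (\<forall>t\<ge>a. (X has_vector_derivative blinfun_apply (L t) (X t)) (at t within {a..}))"
proof -
  define X where "X = (\<lambda>t. \<Sum>n. picard_term a L c n t)"
  have "X a = c"
  proof -
    have "X a = (\<Sum>n. if n = 0 then c else 0)"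
      unfolding X_def by (rule suminf_cong) (auto simp: gr0_conv_Suc)
    also have "\<dots> = c"
      using suminf_finite[of "{0::nat}" "\<lambda>n. if n = 0 then c else 0"] by simp
    finally show ?thesis .
  qed
  moreover have "(X has_vector_derivative blinfun_apply (L t) (X t)) (at t within {a..})" if t: "a \<le> t" for t
  proof -
    (* b lies beyond t, so that the derivative at t within {a..b} is the one within {a..} *)
    define b where "b = t + 1"
    have cI: "continuous_on {a..b} L"
      by (rule continuous_on_subset[OF L]) auto
    have "bounded (L ` {a..b})"
      by (intro compact_imp_bounded compact_continuous_image cI) auto
    then obtain K where K: "0 < K" "\<And>s. a \<le> s \<Longrightarrow> s \<le> b \<Longrightarrow> norm (L s) \<le> K"
      unfolding bounded_pos by auto
    define B where "B = norm c * exp (2 * K * (b - a))"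
    have term_le: "norm (picard_term a L c n s) \<le> B * (1/2) ^ n" if "s \<in> {a..b}" for n s
    proof -
      have "norm (picard_term a L c n s) \<le> norm c * (1/2) ^ n * exp (2 * K * (s - a))"
        by (rule norm_picard_term_le[OF L K]) (use that in auto)
      also have "\<dots> \<le> norm c * (1/2) ^ n * exp (2 * K * (b - a))"
        using that K by (intro mult_left_mono) auto
      finally show ?thesis by (simp add: B_def mult_ac)
    qed
    have slope_le: "norm (picard_slope a L c n s) \<le> 2 * K * B * (1/2) ^ n" if s: "s \<in> {a..b}" for n s
    proof (cases n)
      case 0
      then show ?thesis using K by (simp add: B_def)
    next
      case (Suc m)
      have "norm (picard_slope a L c n s) \<le> norm (L s) * norm (picard_term a L c m s)"
        by (simp add: norm_blinfun Suc)
      also have "\<dots> \<le> K * (B * (1/2) ^ m)"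
        using s K term_le[OF s, of m] by (intro mult_mono) auto
      finally show ?thesis by (simp add: Suc)
    qed
    have summ: "summable (\<lambda>n. C * (1/2::real) ^ n)" for C
      by (intro summable_mult summable_geometric) auto
    have sums_term: "summable (\<lambda>n. picard_term a L c n s)" if "s \<in> {a..b}" for s
      by (rule summable_comparison_test'[OF summ]) (rule term_le[OF that])
    have sums_slope: "(\<lambda>n. picard_slope a L c n s) sums blinfun_apply (L s) (X s)"
      if s: "s \<in> {a..b}" for s
    proof -
      have "(\<lambda>n. picard_slope a L c (Suc n) s) sums blinfun_apply (L s) (X s)"
        unfolding X_def picard_slope.simps
        by (intro bounded_linear.sums[OF blinfun.bounded_linear_right] summable_sums sums_term s)
      then show ?thesis
        by (subst (asm) sums_Suc_iff) simp
    qed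
    have unif: "uniform_limit {a..b} (\<lambda>n s. \<Sum>i<n. picard_slope a L c i s)
        (\<lambda>s. blinfun_apply (L s) (X s)) sequentially"
    proof -
      have "uniform_limit {a..b} (\<lambda>n s. \<Sum>i<n. picard_slope a L c i s)
          (\<lambda>s. \<Sum>i. picard_slope a L c i s) sequentially"
        by (rule Weierstrass_m_test[OF slope_le summ])
      then show ?thesis
        by (rule uniform_limit_cong'[THEN iffD1, rotated -1])
          (use sums_slope in \<open>auto simp: sums_iff\<close>)
    qed
    have "\<exists>g. \<forall>s\<in>{a..b}. (\<lambda>n. picard_term a L c n s) sums g s \<and>
        (g has_derivative (\<lambda>h. h *\<^sub>R blinfun_apply (L s) (X s))) (at s within {a..b})"
    proof (rule has_derivative_series)
      show "(picard_term a L c n has_derivative (\<lambda>h. h *\<^sub>R picard_slope a L c n s)) (at s within {a..b})"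
        if "s \<in> {a..b}" for n s
        using picard_term_has_derivative[OF L, of s c n] that
        unfolding has_vector_derivative_def
        by (auto intro: has_derivative_subset)
      show "\<forall>\<^sub>F n in sequentially. \<forall>s\<in>{a..b}. \<forall>h.
          norm ((\<Sum>i<n. h *\<^sub>R picard_slope a L c i s) - h *\<^sub>R blinfun_apply (L s) (X s)) \<le> e * norm h"
        if e: "0 < e" for e
        using uniform_limitD[OF unif e]
      proof eventually_elim
        case (elim n)
        show ?case
        proof (intro ballI allI)
          fix s and h :: real assume "s \<in> {a..b}"
          then have le: "norm ((\<Sum>i<n. picard_slope a L c i s) - blinfun_apply (L s) (X s)) \<le> e"
            using elim by (auto simp: dist_norm less_imp_le)
          have "norm ((\<Sum>i<n. h *\<^sub>R picard_slope a L c i s) - h *\<^sub>R blinfun_apply (L s) (X s))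
              = \<bar>h\<bar> * norm ((\<Sum>i<n. picard_slope a L c i s) - blinfun_apply (L s) (X s))"
            by (simp flip: scaleR_sum_right scaleR_diff_right)
          also have "\<dots> \<le> \<bar>h\<bar> * e"
            by (rule mult_left_mono[OF le]) simp
          finally show "norm ((\<Sum>i<n. h *\<^sub>R picard_slope a L c i s) - h *\<^sub>R blinfun_apply (L s) (X s))
              \<le> e * norm h"
            by (simp add: mult.commute)
        qed
      qed
      show "t \<in> {a..b}" using t by (simp add: b_def)
      then show "(\<lambda>n. picard_term a L c n t) sums X t"
        unfolding X_def by (intro summable_sums sums_term)
    qed auto
    then obtain g where g: "\<And>s. s \<in> {a..b} \<Longrightarrow> (\<lambda>n. picard_term a L c n s) sums g s"
      "\<And>s. s \<in> {a..b} \<Longrightarrow> (g has_derivative (\<lambda>h. h *\<^sub>R blinfun_apply (L s) (X s))) (at s within {a..b})"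
      by blast
    have Xg: "X s = g s" if "s \<in> {a..b}" for s
      using g(1)[OF that] by (simp add: X_def sums_iff)
    have tb: "t \<in> {a..b}" using t by (simp add: b_def)
    have "(X has_vector_derivative blinfun_apply (L t) (X t)) (at t within {a..b})"
      unfolding has_vector_derivative_def
      by (rule has_derivative_transform[of t "{a..b}" X g]) (fact tb Xg g(2)[OF tb])+
    then show ?thesis
      using at_within_atLeast_eq_Icc[of a t b] t by (simp add: b_def)
  qed
  ultimately show ?thesis by blast
qed

lemma increasing_from_deriv_pos:
  fixes f :: "real \<Rightarrow> real"
  assumes f: "\<And>x. a \<le> x \<Longrightarrow> (f has_real_derivative f' x) (at x within {a..})"
    and "a \<le> s" "s < t" and pos: "\<And>x. s < x \<Longrightarrow> x < t \<Longrightarrow> 0 < f' x"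
  shows "f s < f t"
proof (rule DERIV_pos_imp_increasing_open[OF \<open>s < t\<close>])
  show "\<exists>y. DERIV f x :> y \<and> y > 0" if "s < x" "x < t" for x
  proof -
    have "at x within {a..} = at x"
      using that assms by (intro at_within_interior) auto
    with f[of x] that assms pos[of x] show ?thesis by auto
  qed
  have "continuous_on {a..} f"
    using f by (auto intro!: DERIV_continuous_on)
  then show "continuous_on {s..t} f"
    by (rule continuous_on_subset) (use assms in auto)
qed

text \<open>If \<open>K\<close> bounds the coefficient, Cauchy-Schwarz gives \<open>(X \<bullet> X)' \<le> 2 K (X \<bullet> X)\<close>, so the damped energy
  \<open>exp (- 2 K s) (X \<bullet> X)\<close> cannot increase from its initial value \<open>0\<close>.\<close>

lemma linear_ivp_zero_unique:
  fixes L :: "real \<Rightarrow> ('a::{banach,real_inner}) \<Rightarrow>\<^sub>L 'a"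
  assumes L: "continuous_on {a..} L" and X0: "X a = 0"
    and X: "\<And>t. a \<le> t \<Longrightarrow> (X has_vector_derivative blinfun_apply (L t) (X t)) (at t within {a..})"
    and t: "a \<le> t"
  shows "X t = 0"
proof -
  have "continuous_on {a..t} L"
    by (rule continuous_on_subset[OF L]) auto
  then have "bounded (L ` {a..t})"
    by (intro compact_imp_bounded compact_continuous_image) auto
  then obtain K where K: "0 < K" "\<And>s. a \<le> s \<Longrightarrow> s \<le> t \<Longrightarrow> norm (L s) \<le> K"
    unfolding bounded_pos by auto
  define E where "E = (\<lambda>s. exp (- (2 * K * s)) * (X s \<bullet> X s))"
  have E: "(E has_real_derivative
      exp (- (2 * K * s)) * (2 * (X s \<bullet> blinfun_apply (L s) (X s)) - 2 * K * (X s \<bullet> X s)))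
      (at s within {a..})" if "a \<le> s" for s
  proof -
    have "((\<lambda>s. X s \<bullet> X s) has_vector_derivative 2 * (X s \<bullet> blinfun_apply (L s) (X s)))
        (at s within {a..})"
      using bounded_bilinear.has_vector_derivative[OF bounded_bilinear_inner X[OF that] X[OF that]]
      by (simp add: inner_commute)
    then have "((\<lambda>s. X s \<bullet> X s) has_real_derivative 2 * (X s \<bullet> blinfun_apply (L s) (X s)))
        (at s within {a..})"
      by (simp add: has_real_derivative_iff_has_vector_derivative)
    then show ?thesis
      unfolding E_def by (auto intro!: derivative_eq_intros simp: algebra_simps)
  qed
  have "E t \<le> E a"
  proof (rule DERIV_nonpos_imp_decreasing_open[OF t])
    show "continuous_on {a..t} E"
      using E by (intro continuous_on_subset[OF DERIV_continuous_on[of "{a..}"]]) auto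
    fix s assume s: "a < s" "s < t"
    have "at s within {a..} = at s"
      using s by (intro at_within_interior) auto
    moreover have "X s \<bullet> blinfun_apply (L s) (X s) \<le> K * (X s \<bullet> X s)"
    proof -
      have "X s \<bullet> blinfun_apply (L s) (X s) \<le> norm (X s) * norm (blinfun_apply (L s) (X s))"
        by (rule norm_cauchy_schwarz)
      also have "\<dots> \<le> norm (X s) * (K * norm (X s))"
        using K(2)[of s] s by (intro mult_left_mono order_trans[OF norm_blinfun] mult_right_mono) auto
      finally show ?thesis by (simp add: dot_square_norm power2_eq_square mult_ac)
    qed
    ultimately show "\<exists>y. DERIV E s :> y \<and> y \<le> 0"
      using E[of s] s by (intro exI conjI) (auto simp: mult_le_0_iff)
  qed
  moreover have "E a = 0"
    by (simp add: E_def X0)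
  ultimately have "X t \<bullet> X t \<le> 0"
    by (simp add: E_def mult_le_0_iff)
  then show ?thesis
    by (metis inner_eq_zero_iff inner_ge_zero order_antisym)
qed

lemma first_zero_exists:
  fixes f :: "real \<Rightarrow> real"
  assumes f: "continuous_on {a..} f" and "0 < f a" "a \<le> c" "f c \<le> 0"
  obtains s where "a < s" "s \<le> c" "f s = 0" "\<And>x. a \<le> x \<Longrightarrow> x < s \<Longrightarrow> 0 < f x"
proof -
  define Z where "Z = {x \<in> {a..}. f x = 0}"
  have ivt: "\<exists>z\<in>Z. z \<le> x" if x: "a \<le> x" "f x \<le> 0" for x
  proof -
    have "continuous_on {a..x} f"
      by (rule continuous_on_subset[OF f]) auto
    then obtain z where "a \<le> z" "z \<le> x" "f z = 0"
      using IVT2'[of f x 0 a] assms x by auto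
    then show ?thesis by (auto simp: Z_def)
  qed
  have "closed Z"
    unfolding Z_def by (rule continuous_closed_preimage_constant[OF f]) simp
  moreover have "Z \<noteq> {}" using ivt assms by blast
  moreover have bb: "bdd_below Z" by (auto simp: Z_def intro!: bdd_belowI[of _ a])
  ultimately have Z: "Inf Z \<in> Z" by (intro closed_contains_Inf)
  show thesis
  proof (rule that[of "Inf Z"])
    show "f (Inf Z) = 0" using Z by (simp add: Z_def)
    moreover have "a \<le> Inf Z" using Z by (simp add: Z_def)
    ultimately show "a < Inf Z" using assms by (cases "a = Inf Z") auto
    obtain z where "z \<in> Z" "z \<le> c" using ivt assms by blast
    then show "Inf Z \<le> c" using cInf_lower[OF _ bb] by force
    show "0 < f x" if x: "a \<le> x" "x < Inf Z" for x
    proof (rule ccontr)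
      assume "\<not> 0 < f x"
      then obtain z where "z \<in> Z" "z \<le> x" using ivt x by force
      then show False using cInf_lower[OF _ bb, of z] x by simp
    qed
  qed
qed


section \<open>The equation as a first-order system\<close>

definition quasi_system ::
  "real \<Rightarrow> (real \<Rightarrow> real) \<Rightarrow> (real \<Rightarrow> real) \<Rightarrow> (real \<Rightarrow> real) \<Rightarrow>
    (real \<Rightarrow> real) \<Rightarrow> (real \<Rightarrow> real) \<Rightarrow> (real \<Rightarrow> real) \<Rightarrow> (real \<Rightarrow> real) \<Rightarrow> bool" where
  "quasi_system a r q p y u v T \<longleftrightarrow> (\<forall>x\<ge>a.
     (y has_real_derivative u x) (at x within {a..}) \<and>
     (u has_real_derivative v x / r x) (at x within {a..}) \<and>
     (v has_real_derivative T x + q x * u x) (at x within {a..}) \<and>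
     (T has_real_derivative p x * y x) (at x within {a..}))"

lemma quasi_systemD:
  assumes "quasi_system a r q p y u v T" "a \<le> x"
  shows "(y has_real_derivative u x) (at x within {a..})"
    and "(u has_real_derivative v x / r x) (at x within {a..})"
    and "(v has_real_derivative T x + q x * u x) (at x within {a..})"
    and "(T has_real_derivative p x * y x) (at x within {a..})"
  using assms by (auto simp: quasi_system_def)

lemma quasi_system_continuous:
  assumes "quasi_system a r q p y u v T"
  shows "continuous_on {a..} y" "continuous_on {a..} u" "continuous_on {a..} v" "continuous_on {a..} T"
  using quasi_systemD[OF assms] by (auto intro!: DERIV_continuous_on)

lemma quasi_system_linear_combination:
  assumes "quasi_system a r q p y u v T" "quasi_system a r q p y' u' v' T'"
  shows "quasi_system a r q p (\<lambda>x. c * y x + d * y' x) (\<lambda>x. c * u x + d * u' x)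
    (\<lambda>x. c * v x + d * v' x) (\<lambda>x. c * T x + d * T' x)"
  unfolding quasi_system_def
  by (auto intro!: derivative_eq_intros quasi_systemD[OF assms(1)] quasi_systemD[OF assms(2)]
      simp: algebra_simps add_divide_distrib)

lemma deriv_from_eq:
  assumes "(f has_real_derivative d) (at x within {a..})" "a \<le> x"
  shows "deriv_from a f x = d"
proof -
  have "at x within {a..} = at x within {a..x + 1}"
    using assms by (intro at_within_atLeast_eq_Icc) auto
  moreover have "at x within {a..x + 1} \<noteq> bot"
    using assms by (subst trivial_limit_within) (auto simp: islimpt_Icc)
  ultimately show ?thesis
    using assms unfolding deriv_from_def has_real_derivative_iff_has_vector_derivative
    by (intro vector_derivative_within) auto
qed

lemma deriv_from_cong:
  assumes "\<And>x. a \<le> x \<Longrightarrow> f x = g x" "a \<le> x"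
  shows "deriv_from a f x = deriv_from a g x"
proof -
  have "(f has_vector_derivative d) (at x within {a..}) \<longleftrightarrow>
      (g has_vector_derivative d) (at x within {a..})" for d
    using has_vector_derivative_transform[of x "{a..}" f g d]
      has_vector_derivative_transform[of x "{a..}" g f d] assms by auto
  then show ?thesis by (simp add: deriv_from_def vector_derivative_def)
qed

lemma cont_diff_from_iff:
  "cont_diff_from a f \<longleftrightarrow>
    (\<forall>x\<ge>a. (f has_real_derivative deriv_from a f x) (at x within {a..})) \<and>
    continuous_on {a..} (deriv_from a f)"
proof -
  have "f differentiable at x within {a..} \<longleftrightarrow>
      (f has_real_derivative deriv_from a f x) (at x within {a..})" for x
    unfolding deriv_from_def has_real_derivative_iff_has_vector_derivative
    by (rule vector_derivative_works)
  then show ?thesis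
    by (auto simp: cont_diff_from_def differentiable_on_def)
qed

lemma cont_diff_fromI:
  assumes "\<And>x. a \<le> x \<Longrightarrow> (f has_real_derivative f' x) (at x within {a..})"
    and "continuous_on {a..} f'"
  shows "cont_diff_from a f"
proof -
  have eq: "deriv_from a f x = f' x" if "a \<le> x" for x
    using deriv_from_eq[OF assms(1)[OF that] that] .
  then have "continuous_on {a..} (deriv_from a f)"
    using assms(2) by (subst continuous_on_cong[of _ "{a..}" _ f']) auto
  with eq assms(1) show ?thesis by (auto simp: cont_diff_from_iff)
qed

lemma cont_diff_from_cong:
  assumes "\<And>x. a \<le> x \<Longrightarrow> f x = g x" "cont_diff_from a g"
  shows "cont_diff_from a f"
proof (rule cont_diff_fromI)
  show "continuous_on {a..} (deriv_from a g)"
    using assms(2) by (simp add: cont_diff_from_iff)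
  show "(f has_real_derivative deriv_from a g x) (at x within {a..})" if "a \<le> x" for x
    using assms that
    by (auto simp: cont_diff_from_iff has_real_derivative_iff_has_vector_derivative
        intro!: has_vector_derivative_transform[of x "{a..}" f g])
qed

locale quasi_equation =
  fixes a :: real and r q p :: "real \<Rightarrow> real"
  assumes cont_r: "continuous_on {a..} r" and cont_q: "continuous_on {a..} q"
    and cont_p: "continuous_on {a..} p"
    and r_pos: "a \<le> x \<Longrightarrow> 0 < r x" and p_pos: "a \<le> x \<Longrightarrow> 0 < p x"
begin

abbreviation system where "system \<equiv> quasi_system a r q p"

lemma solution_imp_system:
  assumes "is_solution a r q p y"
  shows "system y (deriv_from a y) (quasi_y1 a r y) (quasi_T a r q y)"
proof -
  have "deriv_from a (deriv_from a y) x = quasi_y1 a r y x / r x" if "a \<le> x" for x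
    using r_pos[OF that] by (simp add: quasi_y1_def)
  moreover have "deriv_from a (quasi_y1 a r y) x = quasi_T a r q y x + q x * deriv_from a y x" for x
    by (simp add: quasi_T_def)
  ultimately show ?thesis
    using assms unfolding quasi_system_def is_solution_def cont_diff_from_iff by metis
qed

lemma
  assumes sys: "system y u v T"
  shows system_imp_solution: "is_solution a r q p y"
    and system_deriv: "a \<le> x \<Longrightarrow> deriv_from a y x = u x"
    and system_deriv2: "a \<le> x \<Longrightarrow> deriv_from a (deriv_from a y) x = v x / r x"
    and system_y1: "a \<le> x \<Longrightarrow> quasi_y1 a r y x = v x"
    and system_T: "a \<le> x \<Longrightarrow> quasi_T a r q y x = T x"
proof -
  note D = quasi_systemD[OF sys]
  note C = quasi_system_continuous[OF sys]
  show u: "deriv_from a y x = u x" if "a \<le> x" for x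
    using deriv_from_eq[OF D(1)[OF that] that] .
  show u': "deriv_from a (deriv_from a y) x = v x / r x" if "a \<le> x" for x
    using deriv_from_eq[OF D(2)] deriv_from_cong[OF u] that by simp
  show v: "quasi_y1 a r y x = v x" if "a \<le> x" for x
    using u'[OF that] r_pos[OF that] by (simp add: quasi_y1_def)
  show T: "quasi_T a r q y x = T x" if "a \<le> x" for x
    using deriv_from_eq[OF D(3)] deriv_from_cong[OF v] u that by (simp add: quasi_T_def)
  have "deriv_from a (quasi_T a r q y) x = p x * y x" if "a \<le> x" for x
    using deriv_from_eq[OF D(4)] deriv_from_cong[OF T] that by simp
  moreover have "cont_diff_from a y"
    using D C by (intro cont_diff_fromI[of _ _ u]) auto
  moreover have "cont_diff_from a u"
  proof (rule cont_diff_fromI[OF D(2)])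
    show "continuous_on {a..} (\<lambda>x. v x / r x)"
      using r_pos by (intro continuous_intros C cont_r) force
  qed
  moreover have "cont_diff_from a v"
    by (rule cont_diff_fromI[OF D(3)]) (auto intro!: continuous_intros C cont_q)
  moreover have "cont_diff_from a T"
    by (rule cont_diff_fromI[OF D(4)]) (auto intro!: continuous_intros C cont_p)
  ultimately show "is_solution a r q p y"
    unfolding is_solution_def
    using cont_diff_from_cong[OF u] cont_diff_from_cong[OF v] cont_diff_from_cong[OF T] by auto
qed

text \<open>Writing the coefficient as a combination of constant operators with scalar functions as
  factors makes its continuity in operator norm immediate.\<close>

definition coeff :: "real \<Rightarrow> (real \<times> real \<times> real \<times> real) \<Rightarrow>\<^sub>L (real \<times> real \<times> real \<times> real)" where
  "coeff x = Blinfun (\<lambda>(y, u, v, T). (u, 0, T, 0)) + (1 / r x) *\<^sub>R Blinfun (\<lambda>(y, u, v, T). (0, v, 0, 0))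
    + q x *\<^sub>R Blinfun (\<lambda>(y, u, v, T). (0, 0, u, 0)) + p x *\<^sub>R Blinfun (\<lambda>(y, u, v, T). (0, 0, 0, y))"

lemma coeff_apply: "blinfun_apply (coeff x) (y, u, v, T) = (u, v / r x, T + q x * u, p x * y)"
proof -
  have "bounded_linear (\<lambda>(y, u, v, T). (u, 0, T, 0) :: real \<times> real \<times> real \<times> real)"
    "bounded_linear (\<lambda>(y, u, v, T). (0, v, 0, 0) :: real \<times> real \<times> real \<times> real)"
    "bounded_linear (\<lambda>(y, u, v, T). (0, 0, u, 0) :: real \<times> real \<times> real \<times> real)"
    "bounded_linear (\<lambda>(y, u, v, T). (0, 0, 0, y) :: real \<times> real \<times> real \<times> real)"
    unfolding split_beta
    by (intro bounded_linear_Pair bounded_linear_zero bounded_linear_compose[OF bounded_linear_fst]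
        bounded_linear_compose[OF bounded_linear_snd] bounded_linear_fst bounded_linear_snd)+
  note apply_eq = this[THEN bounded_linear_Blinfun_apply]
  show ?thesis
    by (simp add: coeff_def blinfun.add_left blinfun.scaleR_left apply_eq)
qed

lemma continuous_on_coeff: "continuous_on {a..} coeff"
  unfolding coeff_def using r_pos by (intro continuous_intros cont_r cont_q cont_p) force

lemma system_exists:
  "\<exists>y u v T. system y u v T \<and> y a = y0 \<and> u a = u0 \<and> v a = v0 \<and> T a = T0"
proof -
  obtain X where X0: "X a = (y0, u0, v0, T0)" and X: "\<And>x. a \<le> x \<Longrightarrow>
      (X has_vector_derivative blinfun_apply (coeff x) (X x)) (at x within {a..})"
    using linear_ivp_solution_exists[OF continuous_on_coeff] by blast
  define y u v T where "y = (\<lambda>x. fst (X x))" and "u = (\<lambda>x. fst (snd (X x)))"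
    and "v = (\<lambda>x. fst (snd (snd (X x))))" and "T = (\<lambda>x. snd (snd (snd (X x))))"
  note XD = y_def u_def v_def T_def
  have DX: "(X has_vector_derivative (u x, v x / r x, T x + q x * u x, p x * y x)) (at x within {a..})"
    if "a \<le> x" for x
    using X[OF that] coeff_apply[of x "y x" "u x" "v x" "T x"] by (simp add: XD)
  have "system y u v T"
    unfolding quasi_system_def has_real_derivative_iff_has_vector_derivative XD
    using bounded_linear.has_vector_derivative[OF bounded_linear_fst DX]
      bounded_linear.has_vector_derivative[OF bounded_linear_compose[OF bounded_linear_fst bounded_linear_snd] DX]
      bounded_linear.has_vector_derivative[OF bounded_linear_compose[OF bounded_linear_fst
          bounded_linear_compose[OF bounded_linear_snd bounded_linear_snd]] DX]
      bounded_linear.has_vector_derivative[OF bounded_linear_compose[OF bounded_linear_snd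
          bounded_linear_compose[OF bounded_linear_snd bounded_linear_snd]] DX]
    by (auto simp: XD)
  moreover have "y a = y0 \<and> u a = u0 \<and> v a = v0 \<and> T a = T0"
    by (simp add: XD X0)
  ultimately have "system y u v T \<and> y a = y0 \<and> u a = u0 \<and> v a = v0 \<and> T a = T0" ..
  then show ?thesis
    by (rule exI[of _ y, OF exI[of _ u, OF exI[of _ v, OF exI[of _ T]]]])
qed

lemma system_zero_unique:
  assumes sys: "system y u v T" and "y a = 0" "u a = 0" "v a = 0" "T a = 0" and x: "a \<le> x"
  shows "y x = 0 \<and> u x = 0 \<and> v x = 0 \<and> T x = 0"
proof -
  define X where "X = (\<lambda>x. (y x, u x, v x, T x))"
  have DX: "(X has_vector_derivative blinfun_apply (coeff s) (X s)) (at s within {a..})" if "a \<le> s" for s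
    unfolding X_def coeff_apply
    by (intro has_vector_derivative_Pair
        quasi_systemD[OF sys that, unfolded has_real_derivative_iff_has_vector_derivative])
  have "X a = 0"
    using assms(2-5) by (simp add: X_def zero_prod_def)
  then have "X x = 0"
    using linear_ivp_zero_unique[OF continuous_on_coeff, of X x] DX x by blast
  then show ?thesis by (simp add: X_def zero_prod_def)
qed

lemma system_cong:
  assumes "system y u v T" "\<And>x. a \<le> x \<Longrightarrow> z x = y x"
  shows "system z u v T"
proof -
  have "(z has_real_derivative u x) (at x within {a..})" if "a \<le> x" for x
    using has_vector_derivative_transform[of x "{a..}" z y "u x"] quasi_systemD(1)[OF assms(1) that]
      assms(2) that by (simp add: has_real_derivative_iff_has_vector_derivative)
  then show ?thesis
    using quasi_systemD[OF assms(1)] assms(2) by (simp add: quasi_system_def)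
qed

end

section \<open>Two fundamental solutions and their minors\<close>

locale fundamental_pair = quasi_equation +
  fixes y1 u1 v1 T1 y2 u2 v2 T2 :: "real \<Rightarrow> real"
  assumes sys1: "system y1 u1 v1 T1" and sys2: "system y2 u2 v2 T2"
    and init1: "y1 a = 0" "u1 a = 1" "v1 a = 0" "T1 a = 0"
    and init2: "y2 a = 0" "u2 a = 0" "v2 a = 0" "T2 a = 1"
begin

text \<open>The determinant of the two boundary conditions at \<open>x\<close> on the plane spanned by the two
  solutions.\<close>

definition minor_uT :: "real \<Rightarrow> real" where
  "minor_uT x = u1 x * T2 x - u2 x * T1 x"

definition minor_uv :: "real \<Rightarrow> real" where
  "minor_uv x = u1 x * v2 x - u2 x * v1 x"

lemma minor_uT_a: "minor_uT a = 1"
  by (simp add: minor_uT_def init1 init2)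

lemma continuous_on_minor_uT: "continuous_on {a..} minor_uT"
  unfolding minor_uT_def
  by (intro continuous_intros quasi_system_continuous[OF sys1] quasi_system_continuous[OF sys2])

text \<open>In the derivative the products coming from \<open>u' = v / r\<close> are \<open>v1 v2 / r\<close> with both signs, those
  coming from \<open>q u\<close> in \<open>v'\<close> are \<open>q u1 u2\<close> with both signs, and only the coupling of \<open>v\<close> to \<open>T\<close>
  survives.\<close>

lemma minor_uv_has_derivative:
  assumes "a \<le> x"
  shows "(minor_uv has_real_derivative minor_uT x) (at x within {a..})"
proof -
  note D1 = quasi_systemD[OF sys1 assms] and D2 = quasi_systemD[OF sys2 assms]
  show ?thesis
    unfolding minor_uv_def minor_uT_def
    by (rule derivative_eq_intros D1 D2 refl)+ (simp add: algebra_simps)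
qed

lemma minor_uv_pos:
  assumes W: "\<And>x. a \<le> x \<Longrightarrow> x < \<mu> \<Longrightarrow> 0 < minor_uT x" and x: "a < x" "x \<le> \<mu>"
  shows "0 < minor_uv x"
proof -
  have "minor_uv a < minor_uv x"
    by (rule increasing_from_deriv_pos[OF minor_uv_has_derivative]) (use W x in auto)
  then show ?thesis by (simp add: minor_uv_def init1 init2)
qed

text \<open>At \<open>a\<close> one has \<open>v2' = T2 = 1\<close>, and two integrations carry this sign over to \<open>u2\<close>. The estimate
  starts the first-zero argument below, which cannot begin at \<open>a\<close> because \<open>u2 a = 0\<close>.\<close>

lemma u2_pos_near: "\<exists>d>0. \<forall>x. a < x \<longrightarrow> x < a + d \<longrightarrow> 0 < u2 x"
proof -
  note D2 = quasi_systemD[OF sys2]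
  have "continuous_on {a..} (\<lambda>x. T2 x + q x * u2 x)"
    by (intro continuous_intros quasi_system_continuous[OF sys2] cont_q)
  then have "((\<lambda>x. T2 x + q x * u2 x) \<longlongrightarrow> T2 a + q a * u2 a) (at a within {a..})"
    by (auto simp: continuous_on_def)
  then have "\<forall>\<^sub>F x in at a within {a..}. 0 < T2 x + q x * u2 x"
    by (rule order_tendstoD) (simp add: init2)
  then obtain d where d: "0 < d" "\<And>x. a < x \<Longrightarrow> x < a + d \<Longrightarrow> 0 < T2 x + q x * u2 x"
    unfolding eventually_at by (force simp: dist_real_def)
  have v: "0 < v2 x" if "a < x" "x < a + d" for x
    using increasing_from_deriv_pos[OF D2(3), of a x] that d by (auto simp: init2)
  have "0 < u2 x" if "a < x" "x < a + d" for x
    using increasing_from_deriv_pos[OF D2(2), of a x] that v r_pos by (auto simp: init2)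
  then show ?thesis using d by blast
qed

text \<open>Up to a first zero \<open>s\<close> of \<open>u2\<close> also \<open>y2\<close> is positive, whence \<open>T2 s > 1\<close>. The values at \<open>s\<close> of the two
  minors reduce to \<open>u1 s * T2 s\<close> and \<open>u1 s * v2 s\<close>, and their signs contradict \<open>v2 s \<le> 0\<close>, which holds
  because \<open>u2\<close> reaches zero from above.\<close>

lemma u2_pos:
  assumes W: "\<And>x. a \<le> x \<Longrightarrow> x < \<mu> \<Longrightarrow> 0 < minor_uT x" "0 \<le> minor_uT \<mu>"
    and x: "a < x" "x \<le> \<mu>"
  shows "0 < u2 x"
proof (rule ccontr)
  assume neg: "\<not> 0 < u2 x"
  note D2 = quasi_systemD[OF sys2]
  obtain d where d: "0 < d" "\<And>x. a < x \<Longrightarrow> x < a + d \<Longrightarrow> 0 < u2 x"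
    using u2_pos_near by blast
  define c where "c = a + d / 2"
  have c: "a < c" "c \<le> x" "0 < u2 c"
    using d neg x by (force simp: c_def)+
  have "continuous_on {c..} u2"
    by (rule continuous_on_subset[OF quasi_system_continuous(2)[OF sys2]]) (use c in auto)
  then obtain s where s: "c < s" "s \<le> x" "u2 s = 0" "\<And>t. c \<le> t \<Longrightarrow> t < s \<Longrightarrow> 0 < u2 t"
    using first_zero_exists[of c u2 x] c neg by (metis not_less)
  have u_pos: "0 < u2 t" if "a < t" "t < s" for t
    using s(4)[of t] d(2)[of t] that d(1) by (cases "c \<le> t") (auto simp: c_def)
  have y_pos: "0 < y2 t" if "a < t" "t < s" for t
    using increasing_from_deriv_pos[OF D2(1), of a t] u_pos that by (auto simp: init2)
  have "T2 a < T2 s"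
    by (rule increasing_from_deriv_pos[OF D2(4)]) (use y_pos p_pos s c in auto)
  then have "0 < T2 s" by (simp add: init2)
  moreover have "0 \<le> minor_uT s"
    using W(1)[of s] W(2) s x c by (cases "s = \<mu>") (auto intro: less_imp_le)
  ultimately have u1: "0 \<le> u1 s"
    using s(3) by (simp add: minor_uT_def zero_le_mult_iff)
  have "v2 s \<le> 0"
  proof (rule ccontr)
    assume "\<not> v2 s \<le> 0"
    then have "0 < v2 s / r s"
      using r_pos[of s] s c by simp
    with D2(2)[of s] obtain e where e: "0 < e"
      "\<And>h. 0 < h \<Longrightarrow> s - h \<in> {a..} \<Longrightarrow> h < e \<Longrightarrow> u2 (s - h) < u2 s"
      using has_real_derivative_pos_inc_left[of u2 "v2 s / r s" s "{a..}"] s c by auto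
    (* a step back from s that stays within (a, s), where u2 is positive *)
    define h where "h = min (e / 2) ((s - a) / 2)"
    have "0 < h" "h < e" "a < s - h"
      using e(1) s c by (auto simp: h_def min_def field_simps)
    then show False
      using e(2)[of h] u_pos[of "s - h"] s(3) by auto
  qed
  moreover have "0 < u1 s * v2 s"
    using minor_uv_pos[OF W(1), of \<mu> s] s c x by (auto simp: minor_uv_def)
  ultimately show False
    using u1 by (simp add: zero_less_mult_iff)
qed

text \<open>The derivative of the quotient is \<open>- minor_uv / (r * u2^2)\<close>.\<close>

lemma ratio_decreasing:
  assumes W: "\<And>x. a \<le> x \<Longrightarrow> x < \<mu> \<Longrightarrow> 0 < minor_uT x" "0 \<le> minor_uT \<mu>"
    and st: "a < s" "s < t" "t \<le> \<mu>"
  shows "u1 t / u2 t < u1 s / u2 s"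
proof -
  have pos: "0 < u2 x" if "s \<le> x" "x \<le> t" for x
    using u2_pos[OF W] that st by auto
  show ?thesis
  proof (rule DERIV_neg_imp_decreasing_open[of s t "\<lambda>x. u1 x / u2 x"])
    have "continuous_on {s..t} u1" "continuous_on {s..t} u2"
      using quasi_system_continuous(2)[OF sys1] quasi_system_continuous(2)[OF sys2] st
      by (auto elim!: continuous_on_subset)
    then show "continuous_on {s..t} (\<lambda>x. u1 x / u2 x)"
      using pos by (intro continuous_intros) force+
    fix x assume x: "s < x" "x < t"
    then have ax: "a \<le> x" and at: "at x within {a..} = at x"
      using st by (auto intro!: at_within_interior)
    have quotient: "((\<lambda>x. u1 x / u2 x) has_real_derivative
        (v1 x / r x * u2 x - u1 x * (v2 x / r x)) / (u2 x * u2 x)) (at x)"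
      using DERIV_divide[OF quasi_systemD(2)[OF sys1 ax] quasi_systemD(2)[OF sys2 ax]] pos[of x] x at
      by auto
    have "v1 x / r x * u2 x - u1 x * (v2 x / r x) = - (minor_uv x / r x)"
      by (simp add: minor_uv_def diff_divide_distrib mult_ac)
    moreover have "0 < minor_uv x / r x"
      using minor_uv_pos[OF W(1), of \<mu> x] r_pos[OF ax] x st by simp
    ultimately have "(v1 x / r x * u2 x - u1 x * (v2 x / r x)) / (u2 x * u2 x) < 0"
      using pos[of x] x by (simp only: neg_less_0_iff_less divide_neg_pos mult_pos_pos less_imp_le)
    with quotient show "\<exists>d. ((\<lambda>x. u1 x / u2 x) has_real_derivative d) (at x) \<and> d < 0"
      by blast
  qed (use st in auto)
qed

text \<open>A solution with the focal conditions at \<open>a\<close> has the same initial data as a combination of the two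
  solutions, so it equals that combination in all four components; the conditions at \<open>b\<close>
  become a homogeneous linear system for the two factors.\<close>

lemma focal_solution_decomposition:
  assumes z: "z \<in> systems_focal_solutions a r q p b" and b: "a \<le> b"
  obtains c d where "\<And>x. a \<le> x \<Longrightarrow> z x = c * y1 x + d * y2 x"
    "c * u1 b + d * u2 b = 0" "c * T1 b + d * T2 b = 0"
proof -
  let ?u = "deriv_from a z" and ?v = "quasi_y1 a r z" and ?T = "quasi_T a r q z"
  define c d where "c = ?u a" and "d = ?T a"
  have z': "system z ?u ?v ?T" "z a = 0" "?v a = 0" "?u b = 0" "?T b = 0"
    using z by (auto simp: systems_focal_solutions_def intro: solution_imp_system)
  note comb = quasi_system_linear_combination[OF sys1 sys2, of c d]
  have "z x - (c * y1 x + d * y2 x) = 0 \<and> ?u x - (c * u1 x + d * u2 x) = 0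
      \<and> ?T x - (c * T1 x + d * T2 x) = 0" if "a \<le> x" for x
    using system_zero_unique[OF quasi_system_linear_combination[OF z'(1) comb, of 1 "-1"] _ _ _ _ that]
    by (simp add: z' init1 init2 c_def d_def)
  then show thesis
    using that[of c d] z' b by fastforce
qed

lemma focal_point_imp_minor_zero:
  assumes "b \<in> systems_focal_points a r q p"
  shows "a < b" "minor_uT b = 0"
proof -
  show b: "a < b"
    using assms by (simp add: systems_focal_points_def)
  obtain z x where z: "z \<in> systems_focal_solutions a r q p b" "a \<le> x" "z x \<noteq> 0"
    using assms by (auto simp: systems_focal_points_def)
  obtain c d where cd: "\<And>x. a \<le> x \<Longrightarrow> z x = c * y1 x + d * y2 x"
    "c * u1 b + d * u2 b = 0" "c * T1 b + d * T2 b = 0"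
    using focal_solution_decomposition[OF z(1)] b by auto
  have "c \<noteq> 0 \<or> d \<noteq> 0"
    using cd(1)[OF z(2)] z(3) by auto
  moreover have "c * minor_uT b = 0" "d * minor_uT b = 0"
    using cd(2,3) unfolding minor_uT_def by algebra+
  ultimately show "minor_uT b = 0" by auto
qed

text \<open>The eigenfunction is \<open>y1 - k * y2\<close>, where \<open>k\<close> is the value at \<open>\<mu>\<close> of the decreasing ratio
  \<open>u1 / u2\<close>. Since \<open>minor_uT\<close> vanishes at \<open>\<mu>\<close>, this factor \<open>k\<close> serves for \<open>u\<close> and for \<open>T\<close> at once.\<close>

lemma first_focal_point:
  assumes "a < \<mu>" and W: "\<And>x. a \<le> x \<Longrightarrow> x < \<mu> \<Longrightarrow> 0 < minor_uT x" and W0: "minor_uT \<mu> = 0"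
  shows "\<exists>y \<in> systems_focal_solutions a r q p \<mu>.
       (\<exists>x\<ge>a. y x \<noteq> 0) \<and>
       (\<forall>z. z \<in> systems_focal_solutions a r q p \<mu> \<longleftrightarrow> (\<exists>c. \<forall>x\<ge>a. z x = c * y x)) \<and>
       (\<forall>x \<in> {a<..<\<mu>}. y x > 0 \<and> deriv_from a y x > 0 \<and> quasi_T a r q y x < 0) \<and>
       ((\<forall>x \<in> {a..<\<mu>}. q x \<le> 0) \<longrightarrow>
          (\<forall>x \<in> {a<..<\<mu>}. deriv_from a (deriv_from a y) x < 0))"
proof -
  define k where "k = u1 \<mu> / u2 \<mu>"
  (* the factor 1 keeps the four components in the form of a linear combination *)
  define y u v T where "y = (\<lambda>x. 1 * y1 x + (- k) * y2 x)" and "u = (\<lambda>x. 1 * u1 x + (- k) * u2 x)"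
    and "v = (\<lambda>x. 1 * v1 x + (- k) * v2 x)" and "T = (\<lambda>x. 1 * T1 x + (- k) * T2 x)"
  note YD = y_def u_def v_def T_def
  have sys: "system y u v T"
    unfolding YD by (rule quasi_system_linear_combination[OF sys1 sys2])
  note D = quasi_systemD[OF sys]
  note [simp] = system_deriv[OF sys] system_deriv2[OF sys] system_y1[OF sys] system_T[OF sys]
  have u2\<mu>: "0 < u2 \<mu>"
    using u2_pos[OF W, of \<mu> \<mu>] W0 assms(1) by simp
  have ini: "y a = 0" "u a = 1" "v a = 0"
    by (simp_all add: YD init1 init2)
  have u\<mu>: "u \<mu> = 0"
    using u2\<mu> by (simp add: u_def k_def)
  have T\<mu>: "T \<mu> = 0"
    using W0 u2\<mu> by (simp add: T_def k_def minor_uT_def field_simps)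
  have u_pos: "0 < u x" if "a < x" "x < \<mu>" for x
  proof -
    have "k < u1 x / u2 x"
      unfolding k_def using ratio_decreasing[OF W, of \<mu> x \<mu>] W0 that by simp
    moreover have "0 < u2 x"
      using u2_pos[OF W, of \<mu> x] W0 that by simp
    ultimately show ?thesis by (simp add: u_def field_simps)
  qed
  have y_pos: "0 < y x" if "a < x" "x < \<mu>" for x
    using increasing_from_deriv_pos[OF D(1), of a x] u_pos that ini by auto
  have T_neg: "T x < 0" if "a < x" "x < \<mu>" for x
    using increasing_from_deriv_pos[OF D(4), of x \<mu>] y_pos p_pos that T\<mu> by auto
  have v_neg: "v x < 0" if "\<forall>x\<in>{a..<\<mu>}. q x \<le> 0" "a < x" "x < \<mu>" for x
  proof -
    have "- v a < - v x"
    proof (rule increasing_from_deriv_pos[of a "\<lambda>x. - v x" "\<lambda>x. - (T x + q x * u x)"])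
      show "0 < - (T s + q s * u s)" if "a < s" "s < x" for s
        using T_neg[of s] u_pos[of s] mult_nonpos_nonneg[of "q s" "u s"] that
          \<open>\<forall>x\<in>{a..<\<mu>}. q x \<le> 0\<close> \<open>x < \<mu>\<close> by auto
      show "((\<lambda>x. - v x) has_real_derivative - (T s + q s * u s)) (at s within {a..})"
        if "a \<le> s" for s
        using DERIV_minus[OF D(3)[OF that]] .
    qed (use that in auto)
    then show ?thesis by (simp add: ini)
  qed
  have scaled: "z \<in> systems_focal_solutions a r q p \<mu>" if z: "\<And>x. a \<le> x \<Longrightarrow> z x = c * y x" for z c
  proof -
    (* the summands with factor 0 bring a scalar multiple into the form of a linear combination *)
    have sz: "system z (\<lambda>x. c * u x + 0 * u x) (\<lambda>x. c * v x + 0 * v x) (\<lambda>x. c * T x + 0 * T x)"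
      by (rule system_cong[OF quasi_system_linear_combination[OF sys sys]]) (simp add: z)
    show ?thesis
      using assms(1) system_imp_solution[OF sz] system_deriv[OF sz] system_y1[OF sz] system_T[OF sz]
      by (simp add: systems_focal_solutions_def z ini u\<mu> T\<mu>)
  qed
  have "z \<in> systems_focal_solutions a r q p \<mu> \<longleftrightarrow> (\<exists>c. \<forall>x\<ge>a. z x = c * y x)" for z
  proof
    assume "z \<in> systems_focal_solutions a r q p \<mu>"
    then obtain c d where cd: "\<And>x. a \<le> x \<Longrightarrow> z x = c * y1 x + d * y2 x" "c * u1 \<mu> + d * u2 \<mu> = 0"
      using focal_solution_decomposition assms(1) by (metis less_imp_le)
    then have "d = - c * k"
      using u2\<mu> by (simp add: k_def field_simps)
    then show "\<exists>c. \<forall>x\<ge>a. z x = c * y x"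
      using cd(1) by (auto simp: y_def algebra_simps intro!: exI[of _ c])
  qed (use scaled in blast)
  moreover have "\<exists>x\<ge>a. y x \<noteq> 0"
    using y_pos[of "(a + \<mu>) / 2"] assms(1) by (intro exI[of _ "(a + \<mu>) / 2"]) auto
  moreover have "y \<in> systems_focal_solutions a r q p \<mu>"
    using scaled[of y 1] by simp
  ultimately show ?thesis
    using y_pos u_pos T_neg v_neg r_pos
    by (intro bexI[of _ y]) (auto simp: divide_neg_pos)
qed

end

section \<open>The first systems-focal point\<close>

theorem theorem4p1:
  fixes a :: real and r q p :: "real \<Rightarrow> real"
  assumes "a \<ge> 0"
    and "continuous_on {a..} r" and "continuous_on {a..} q" and "continuous_on {a..} p"
    and "\<forall>x\<ge>a. r x > 0" and "\<forall>x\<ge>a. p x > 0"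
    and "systems_focal_points a r q p \<noteq> {}"
  shows "let \<mu> = mu1_hat a r q p in
    \<mu> \<in> systems_focal_points a r q p \<and> (\<forall>b \<in> systems_focal_points a r q p. \<mu> \<le> b) \<and>
    (\<exists>y \<in> systems_focal_solutions a r q p \<mu>.
       (\<exists>x\<ge>a. y x \<noteq> 0) \<and>
       (\<forall>z. z \<in> systems_focal_solutions a r q p \<mu> \<longleftrightarrow> (\<exists>c. \<forall>x\<ge>a. z x = c * y x)) \<and>
       (\<forall>x \<in> {a<..<\<mu>}. y x > 0 \<and> deriv_from a y x > 0 \<and> quasi_T a r q y x < 0) \<and>
       ((\<forall>x \<in> {a..<\<mu>}. q x \<le> 0) \<longrightarrow>
          (\<forall>x \<in> {a<..<\<mu>}. deriv_from a (deriv_from a y) x < 0)))"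
proof -
  interpret quasi_equation a r q p
    using assms by unfold_locales auto
  obtain y1 u1 v1 T1 where 1: "system y1 u1 v1 T1" "y1 a = 0" "u1 a = 1" "v1 a = 0" "T1 a = 0"
    using system_exists by blast
  obtain y2 u2 v2 T2 where 2: "system y2 u2 v2 T2" "y2 a = 0" "u2 a = 0" "v2 a = 0" "T2 a = 1"
    using system_exists by blast
  interpret fundamental_pair a r q p y1 u1 v1 T1 y2 u2 v2 T2
    using 1 2 by unfold_locales auto
  obtain b where b: "b \<in> systems_focal_points a r q p"
    using assms by blast
  obtain \<mu> where \<mu>: "a < \<mu>" "minor_uT \<mu> = 0" "\<And>x. a \<le> x \<Longrightarrow> x < \<mu> \<Longrightarrow> 0 < minor_uT x"
    using first_zero_exists[OF continuous_on_minor_uT, of b] minor_uT_a focal_point_imp_minor_zero[OF b]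
    by (metis less_imp_le order_refl zero_less_one)
  note first = first_focal_point[OF \<mu>(1,3,2)]
  have mem: "\<mu> \<in> systems_focal_points a r q p"
    using first \<mu>(1) by (auto simp: systems_focal_points_def)
  have le: "\<mu> \<le> b" if "b \<in> systems_focal_points a r q p" for b
    using focal_point_imp_minor_zero[OF that] \<mu>(3)[of b] by force
  have "mu1_hat a r q p = \<mu>"
    unfolding mu1_hat_def by (intro Least_equality mem le)
  then show ?thesis
    by (simp only: Let_def) (intro conjI ballI mem le first)
qed

end
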